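(* For every integer $n\geq 1$, all real numbers $a,b>0$ and all $x$, \[ \sum_{l=0}^{n}\binom{n}{l}\frac{(a)_{l}(b)_{n-l}}{(a+b)_{n}}B_{l}(x)B_{n-l}(x) = \sum_{l=0}^{n}\binom{n}{l}\frac{a(b)_{l}+b(a)_{l}}{(a+b)_{l+1}}B_lB_{n-l}(x) + \frac{ab}{(a+b+1)(a+b)}\,nB_{n-1}(x). \]
   Context: The Bernoulli numbers $B_n$ are defined by $\frac{z}{e^z-1}=\sum_{n\ge0}B_n\frac{z^n}{n!}$ and the Bernoulli polynomials by $B_n(x)=\sum_{j=0}^n\binom{n}{j}B_jx^{n-j}$ (equivalently $\frac{ze^{xz}}{e^z-1}=\sum_{n\ge0}B_n(x)\frac{z^n}{n!}$). The Pochhammer symbol is $(z)_0=1$, $(z)_k=z(z+1)\cdots(z+k-1)$ for $k\ge1$. *)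

theory Defs
  imports Complex_Main "HOL-Computational_Algebra.Formal_Power_Series"
begin

(* The quotient is a genuine one although fps_exp 1 - 1 has zero constant term:
   fps division cancels the common factor fps_X (see bernoulli_fps). *)
definition bernoulli :: "nat \<Rightarrow> real" where
  "bernoulli n = fact n * fps_nth (fps_X / (fps_exp 1 - 1)) n"

definition bernpoly :: "nat \<Rightarrow> 'a::real_field \<Rightarrow> 'a" where
  "bernpoly n x = (\<Sum>j=0..n. of_nat (n choose j) * of_real (bernoulli j) * x ^ (n - j))"

lemma bernoulli_fps:
  "Abs_fps (\<lambda>n. bernoulli n / fact n) * (fps_exp 1 - 1) = fps_X"
proof -
  have "Abs_fps (\<lambda>n. bernoulli n / fact n) = fps_X / (fps_exp 1 - 1)"
    by (rule fps_ext) (simp add: bernoulli_def)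
  moreover have nz: "fps_exp 1 - 1 \<noteq> (0 :: real fps)"
  proof
    assume "fps_exp 1 - 1 = (0 :: real fps)"
    then have "fps_nth (fps_exp 1 - 1 :: real fps) 1 = 0" by simp
    then show False by simp
  qed
  moreover have "subdegree (fps_exp 1 - 1 :: real fps) = 1"
    by (rule subdegreeI) auto
  then have "(fps_exp 1 - 1 :: real fps) dvd fps_X"
    using nz by (simp add: fps_dvd_iff)
  ultimately show ?thesis by (simp add: dvd_div_mult_self)
qed

end

theory Submission
  imports Defs "HOL-Computational_Algebra.Polynomial"
begin

text \<open>
  The coefficient \<open>(a)\<^sub>l (b)\<^sub>m / (a + b)\<^sub>l\<^sub>+\<^sub>m\<close> is the expectation of
  \<open>T\<^sup>l (1 - T)\<^sup>m\<close> for a Beta-distributed variable \<open>T\<close> with parameters \<open>a\<close> and \<open>b\<close>.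
  With \<open>G(z) = z / (e\<^sup>z - 1)\<close>, the identity
  \<open>1 / ((e\<^sup>u - 1) (e\<^sup>v - 1)) = (1 + 1 / (e\<^sup>u - 1) + 1 / (e\<^sup>v - 1)) / (e\<^sup>u\<^sup>+\<^sup>v - 1)\<close> at
  \<open>u = t z\<close>, \<open>v = (1 - t) z\<close> reads
  \<open>G(t z) G((1 - t) z) = G(z) (t (1 - t) z + (1 - t) G(t z) + t G((1 - t) z))\<close>.
  Multiplying by \<open>e\<^sup>x\<^sup>z\<close>, comparing coefficients of \<open>z\<^sup>n\<close>, and taking the expectation over
  \<open>t\<close> yields the theorem. As only polynomials in \<open>t\<close> occur, the expectation is
  the linear functional that sends \<open>t\<^sup>k\<close> to \<open>(a)\<^sub>k / (a + b)\<^sub>k\<close>.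
\<close>

section \<open>Moments of the Beta distribution as a linear functional on polynomials\<close>

definition beta_mean :: "real \<Rightarrow> real \<Rightarrow> 'a::real_field poly \<Rightarrow> 'a" where
  "beta_mean a b p =
     (\<Sum>k\<le>degree p. coeff p k * of_real (pochhammer a k / pochhammer (a + b) k))"

text \<open>The degree can drop under addition and scaling; a common summation bound makes linearity
  a termwise matter.\<close>

lemma beta_mean_eq_sum:
  assumes "degree p \<le> N"
  shows "beta_mean a b p =
    (\<Sum>k\<le>N. coeff p k * of_real (pochhammer a k / pochhammer (a + b) k))"
  unfolding beta_mean_def
  by (rule sum.mono_neutral_left) (use assms in \<open>auto simp: coeff_eq_0\<close>)

lemma beta_mean_0 [simp]: "beta_mean a b 0 = 0"
  by (simp add: beta_mean_def)

lemma beta_mean_add: "beta_mean a b (p + q) = beta_mean a b p + beta_mean a b q"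
proof -
  let ?N = "max (degree p) (degree q)"
  have "degree (p + q) \<le> ?N" by (rule degree_add_le_max)
  then show ?thesis
    by (simp add: beta_mean_eq_sum[of _ ?N] sum.distrib distrib_right add_divide_distrib)
qed

lemma beta_mean_smult: "beta_mean a b (smult c p) = c * beta_mean a b p"
  using beta_mean_eq_sum[OF degree_smult_le, of a b c p]
  by (simp add: beta_mean_def sum_distrib_left mult.assoc)

lemma beta_mean_sum: "beta_mean a b (\<Sum>i\<in>A. f i) = (\<Sum>i\<in>A. beta_mean a b (f i))"
  by (induction A rule: infinite_finite_induct) (simp_all add: beta_mean_add)

lemma beta_mean_power:
  "beta_mean a b ([:0, 1:] ^ k) = of_real (pochhammer a k / pochhammer (a + b) k)"
proof -
  have eq: "[:0, 1:] ^ k = (monom 1 k :: 'a poly)"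
    by (simp add: monom_altdef)
  have "(\<Sum>i\<le>k. (if k = i then 1 else 0 :: 'a)
            * of_real (pochhammer a i / pochhammer (a + b) i))
        = (\<Sum>i\<le>k. if k = i then of_real (pochhammer a i / pochhammer (a + b) i) else 0)"
    by (rule sum.cong) auto
  then show ?thesis
    unfolding eq by (simp add: beta_mean_def degree_monom_eq)
qed

text \<open>Writing \<open>T\<close> and \<open>U = 1 - T\<close> for the two linear polynomials,
  \<open>T ^ l * U ^ Suc m = T ^ l * U ^ m - T ^ Suc l * U ^ m\<close> reduces mixed moments to pure
  ones, so no Beta integral is required. The second term raises \<open>l\<close>, hence the
  induction generalizes over it.\<close>

lemma beta_mean_monomial:
  assumes "a > 0" and "b > 0"
  shows "beta_mean a b ([:0, 1:] ^ l * [:1, -1:] ^ m) =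
    of_real (pochhammer a l * pochhammer b m / pochhammer (a + b) (l + m))"
proof (induction m arbitrary: l)
  case 0
  then show ?case by (simp add: beta_mean_power)
next
  case (Suc m)
  have split: "[:0, 1:] ^ l * [:1, -1:] ^ Suc m =
      [:0, 1:] ^ l * [:1, -1:] ^ m + smult (-1) ([:0, 1:] ^ Suc l * [:1, -1 :: 'a:] ^ m)"
  proof -
    have "[:1, -1:] = 1 - [:0, 1 :: 'a:]"
      by (simp add: one_pCons)
    then have "[:0, 1:] ^ l * [:1, -1:] ^ Suc m =
        [:0, 1:] ^ l * ((1 - [:0, 1:]) * [:1, -1 :: 'a:] ^ m)"
      by simp
    then show ?thesis by (simp add: algebra_simps)
  qed
  \<comment> \<open>Both moments are put over the denominator of length \<open>l + m + 1\<close>,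
    whose last factor is \<open>s\<close>; then \<open>s - (a + l)\<close> is exactly the new factor
    of \<open>pochhammer b (Suc m)\<close>.\<close>
  define s where "s = a + b + real (l + m)"
  have pos: "pochhammer (a + b) (l + m) > 0" "s > 0"
    using assms by (auto simp: s_def intro: pochhammer_pos)
  have Suc_pochhammer: "pochhammer (a + b) (Suc l + m) = pochhammer (a + b) (l + m) * s"
    "pochhammer (a + b) (l + Suc m) = pochhammer (a + b) (l + m) * s"
    by (simp_all add: pochhammer_Suc s_def)
  have "pochhammer a l * pochhammer b m / pochhammer (a + b) (l + m)
      - pochhammer a (Suc l) * pochhammer b m / pochhammer (a + b) (Suc l + m)
      = pochhammer a l * pochhammer b m * (s - (a + l))
        / (pochhammer (a + b) (l + m) * s)"
    unfolding Suc_pochhammer using pos by (simp add: pochhammer_Suc field_simps)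
  also have "s - (a + l) = b + m"
    by (simp add: s_def)
  also have "pochhammer a l * pochhammer b m * (b + m) = pochhammer a l * pochhammer b (Suc m)"
    by (simp add: pochhammer_Suc)
  finally have "pochhammer a l * pochhammer b m / pochhammer (a + b) (l + m)
      - pochhammer a (Suc l) * pochhammer b m / pochhammer (a + b) (Suc l + m)
      = pochhammer a l * pochhammer b (Suc m) / pochhammer (a + b) (l + Suc m)"
    unfolding Suc_pochhammer .
  then show ?case
    by (simp only: split beta_mean_add beta_mean_smult Suc.IH mult_minus1
        add_uminus_conv_diff flip: of_real_diff)
qed

section \<open>Generating functions and the convolution identity\<close>

definition bernoulli_egf :: "'a::real_field \<Rightarrow> 'a fps" where
  "bernoulli_egf t = Abs_fps (\<lambda>n. t ^ n * of_real (bernoulli n) / fact n)"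

definition bernpoly_egf :: "'a::real_field \<Rightarrow> 'a \<Rightarrow> 'a fps" where
  "bernpoly_egf x t = Abs_fps (\<lambda>n. t ^ n * bernpoly n x / fact n)"

text \<open>This is \<open>bernoulli_fps\<close> with \<open>z\<close> replaced by
  \<open>t z\<close>: in each Cauchy product the powers of \<open>t\<close> combine to
  \<open>t ^ n\<close>. The product form also covers \<open>t = 0\<close>.\<close>

lemma bernoulli_egf_mult_exp:
  "bernoulli_egf t * (fps_exp t - 1) = fps_const t * (fps_X :: 'a::real_field fps)"
proof (rule fps_ext)
  fix n
  have "fps_nth (bernoulli_egf t * (fps_exp t - 1)) n =
      (\<Sum>i=0..n. t ^ n * of_real (bernoulli i / fact i * fps_nth (fps_exp 1 - 1) (n - i)))"
    unfolding fps_mult_nth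
    by (rule sum.cong) (auto simp: bernoulli_egf_def power_add[symmetric])
  also have "\<dots> = t ^ n *
      of_real (fps_nth (Abs_fps (\<lambda>n. bernoulli n / fact n) * (fps_exp 1 - 1)) n)"
    by (simp add: fps_mult_nth sum_distrib_left)
  also have "\<dots> = fps_nth (fps_const t * fps_X) n"
    by (cases "n = 1") (auto simp: bernoulli_fps)
  finally show "fps_nth (bernoulli_egf t * (fps_exp t - 1)) n = fps_nth (fps_const t * fps_X) n" .
qed

lemma bernpoly_egf_eq: "bernpoly_egf x t = bernoulli_egf t * fps_exp (t * x)"
proof (rule fps_ext)
  fix n
  have "t ^ n * (of_nat (n choose j) * of_real (bernoulli j) * x ^ (n - j)) / fact n =
      t ^ j * of_real (bernoulli j) / fact j * ((t * x) ^ (n - j) / fact (n - j))"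
    if "j \<in> {0..n}" for j
  proof -
    have "t ^ n = t ^ j * t ^ (n - j)"
      using that by (simp flip: power_add)
    moreover have "(of_nat (n choose j) :: 'a) = fact n / (fact j * fact (n - j))"
      using that by (simp add: binomial_fact)
    ultimately show ?thesis
      by (simp add: power_mult_distrib)
  qed
  then show "fps_nth (bernpoly_egf x t) n = fps_nth (bernoulli_egf t * fps_exp (t * x)) n"
    by (simp add: bernpoly_egf_def bernoulli_egf_def bernpoly_def fps_mult_nth
        sum_distrib_left sum_divide_distrib del: times_divide_eq_left times_divide_eq_right)
qed

lemma bernoulli_egf_product:
  "bernoulli_egf t * bernoulli_egf (1 - t) =
   bernoulli_egf 1 * (fps_const (t * (1 - t)) * fps_X
     + fps_const (1 - t) * bernoulli_egf t + fps_const t * bernoulli_egf (1 - t))"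
\<comment> \<open>For these \<open>t\<close> one of the factors to be cancelled below is zero, but
  the claim is then immediate.\<close>
proof (cases "t = 0 \<or> t = 1")
  case True
  then show ?thesis by auto
next
  case False
  let ?E = "\<lambda>t. fps_exp t - 1 :: 'a fps"
  have nz: "?E s \<noteq> 0" if "s \<noteq> 0" for s
  proof
    assume "?E s = 0"
    then have "fps_nth (?E s) 1 = 0" by simp
    with that show False by simp
  qed
  define F G H where "F = bernoulli_egf t" and "G = bernoulli_egf (1 - t)"
    and "H = (bernoulli_egf 1 :: 'a fps)"
  define c d where "c = fps_const t" and "d = fps_const (1 - t)"
  have F: "F * ?E t = c * fps_X" and G: "G * ?E (1 - t) = d * fps_X" and H: "H * ?E 1 = fps_X"
    unfolding F_def G_def H_def c_def d_def by (simp_all add: bernoulli_egf_mult_exp)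
  \<comment> \<open>This is \<open>e^(u+v) - 1\<close> expanded in \<open>e^u - 1\<close> and
    \<open>e^v - 1\<close>; its three summands yield the three terms on the right-hand side.\<close>
  have E: "?E 1 = ?E t * ?E (1 - t) + ?E t + ?E (1 - t)"
    using fps_exp_add_mult[of t "1 - t"] by (simp add: algebra_simps)
  have "F * G * (?E t * ?E (1 - t) * ?E 1) = (F * ?E t) * (G * ?E (1 - t)) * ?E 1"
    by (simp only: mult_ac)
  also have "\<dots> = c * d * fps_X * fps_X * (?E t * ?E (1 - t) + ?E t + ?E (1 - t))"
    unfolding F G by (subst E) (simp only: mult_ac)
  also have "\<dots> = fps_X * (c * d * fps_X * ?E t * ?E (1 - t)
      + d * (c * fps_X) * ?E (1 - t) + c * (d * fps_X) * ?E t)"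
    by (simp only: distrib_left distrib_right mult_ac add_ac)
  also have "\<dots> = (H * ?E 1) * (c * d * fps_X * ?E t * ?E (1 - t)
      + d * (F * ?E t) * ?E (1 - t) + c * (G * ?E (1 - t)) * ?E t)"
    unfolding F G H ..
  also have "\<dots> = H * (c * d * fps_X + d * F + c * G) * (?E t * ?E (1 - t) * ?E 1)"
    by (simp only: distrib_left distrib_right mult_ac add_ac)
  finally have "F * G = H * (c * d * fps_X + d * F + c * G)"
    using nz[of t] nz[of "1 - t"] nz[of 1] False by simp
  then show ?thesis
    by (simp add: F_def G_def H_def c_def d_def)
qed

text \<open>Since \<open>t + (1 - t) = 1\<close>, the two exponential factors merge into
  \<open>fps_exp x\<close>, which turns \<open>bernoulli_egf 1\<close> into
  \<open>bernpoly_egf x 1\<close>.\<close>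

lemma bernpoly_egf_product:
  "bernpoly_egf x t * bernpoly_egf x (1 - t) =
   fps_const (t * (1 - t)) * (fps_X * bernpoly_egf x 1)
   + (fps_const (1 - t) * bernoulli_egf t + fps_const t * bernoulli_egf (1 - t))
     * bernpoly_egf x 1"
proof -
  have "fps_exp (t * x) * fps_exp ((1 - t) * x) = fps_exp x"
    by (simp add: algebra_simps flip: fps_exp_add_mult)
  then have "bernpoly_egf x t * bernpoly_egf x (1 - t) =
      bernoulli_egf t * bernoulli_egf (1 - t) * fps_exp x"
    by (simp add: bernpoly_egf_eq mult_ac)
  then show ?thesis
    unfolding bernoulli_egf_product by (simp add: bernpoly_egf_eq algebra_simps)
qed

lemma bernpoly_convolution:
  assumes "n \<ge> 1"
  shows "(\<Sum>l=0..n. of_nat (n choose l) * bernpoly l x * bernpoly (n - l) x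
            * (t ^ l * (1 - t) ^ (n - l)))
    = (\<Sum>l=0..n. of_nat (n choose l) * of_real (bernoulli l) * bernpoly (n - l) x
            * (t ^ l * (1 - t) + t * (1 - t) ^ l))
      + of_nat n * bernpoly (n - 1) x * (t * (1 - t))"
proof -
  have binom: "(of_nat (n choose l) :: 'a) = fact n / (fact l * fact (n - l))"
    if "l \<in> {0..n}" for l
    using that by (simp add: binomial_fact)
  \<comment> \<open>The factor \<open>fps_X\<close> shifts the index to \<open>n - 1\<close>, so a
    factor \<open>n\<close> remains from the quotient of factorials.\<close>
  have fact_n: "(fact n :: 'a) = of_nat n * fact (n - 1)"
    using assms by (simp add: fact_reduce)
  have "(\<Sum>l=0..n. of_nat (n choose l) * bernpoly l x * bernpoly (n - l) x
            * (t ^ l * (1 - t) ^ (n - l)))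
      = fact n * fps_nth (bernpoly_egf x t * bernpoly_egf x (1 - t)) n"
    unfolding fps_mult_nth sum_distrib_left
    by (rule sum.cong) (simp_all add: binom bernpoly_egf_def)
  also have "\<dots> = fact n * (t * (1 - t) * (bernpoly (n - 1) x / fact (n - 1)))
      + fact n * fps_nth ((fps_const (1 - t) * bernoulli_egf t
          + fps_const t * bernoulli_egf (1 - t)) * bernpoly_egf x 1) n"
    unfolding bernpoly_egf_product using assms
    by (simp add: distrib_left bernpoly_egf_def)
  also have "fact n * fps_nth ((fps_const (1 - t) * bernoulli_egf t
          + fps_const t * bernoulli_egf (1 - t)) * bernpoly_egf x 1) n
      = (\<Sum>l=0..n. of_nat (n choose l) * of_real (bernoulli l) * bernpoly (n - l) x
            * (t ^ l * (1 - t) + t * (1 - t) ^ l))"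
    unfolding fps_mult_nth[of "_ + _"] sum_distrib_left
    by (rule sum.cong) (simp_all add: binom bernpoly_egf_def bernoulli_egf_def field_simps)
  also have "fact n * (t * (1 - t) * (bernpoly (n - 1) x / fact (n - 1)))
      = of_nat n * bernpoly (n - 1) x * (t * (1 - t))"
    unfolding fact_n by simp
  finally show ?thesis by (simp only: add.commute)
qed

theorem theorem1:
  fixes n :: nat and a b :: real and x :: "'a::real_field"
  assumes "n \<ge> 1" and "a > 0" and "b > 0"
  shows "(\<Sum>l=0..n. of_real (real (n choose l) *
             (pochhammer a l * pochhammer b (n - l) / pochhammer (a + b) n))
             * bernpoly l x * bernpoly (n - l) x)
       = (\<Sum>l=0..n. of_real (real (n choose l) *
             ((a * pochhammer b l + b * pochhammer a l) / pochhammer (a + b) (l + 1))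
             * bernoulli l) * bernpoly (n - l) x)
         + of_real (a * b / ((a + b + 1) * (a + b))) * of_nat n * bernpoly (n - 1) x"
proof -
  let ?T = "[:0, 1:] :: 'a poly" and ?U = "[:1, -1:] :: 'a poly"
  let ?p = "\<Sum>l=0..n. smult (of_nat (n choose l) * bernpoly l x * bernpoly (n - l) x)
      (?T ^ l * ?U ^ (n - l))"
  \<comment> \<open>The exponents \<open>1\<close> are written out so that every summand matches
    \<open>beta_mean_monomial\<close>.\<close>
  let ?q = "(\<Sum>l=0..n. smult (of_nat (n choose l) * of_real (bernoulli l) * bernpoly (n - l) x)
      (?T ^ l * ?U ^ 1 + ?T ^ 1 * ?U ^ l))
      + smult (of_nat n * bernpoly (n - 1) x) (?T ^ 1 * ?U ^ 1)"
  have "poly ?p t = poly ?q t" for t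
  proof -
    have "poly ?T t = t" "poly ?U t = 1 - t" by simp_all
    then show ?thesis
      using bernpoly_convolution[OF assms(1), of x t]
      by (simp only: poly_sum poly_add poly_smult poly_mult poly_power power_one_right)
  qed
  \<comment> \<open>A field of characteristic zero is infinite, so agreement at every
    \<open>t\<close> forces equality of polynomials.\<close>
  then have "?p = ?q"
    by (simp add: poly_eq_poly_eq_iff[symmetric] fun_eq_iff)
  then have "beta_mean a b ?p = beta_mean a b ?q"
    by (rule arg_cong)
  moreover have "beta_mean a b ?p = (\<Sum>l=0..n. of_real (real (n choose l) *
             (pochhammer a l * pochhammer b (n - l) / pochhammer (a + b) n))
             * bernpoly l x * bernpoly (n - l) x)"
    unfolding beta_mean_sum beta_mean_smult beta_mean_monomial[OF assms(2,3)]
    by (rule sum.cong) simp_all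
  moreover have "beta_mean a b ?q = (\<Sum>l=0..n. of_real (real (n choose l) *
             ((a * pochhammer b l + b * pochhammer a l) / pochhammer (a + b) (l + 1))
             * bernoulli l) * bernpoly (n - l) x)
         + of_real (a * b / ((a + b + 1) * (a + b))) * of_nat n * bernpoly (n - 1) x"
    unfolding beta_mean_add beta_mean_sum beta_mean_smult beta_mean_monomial[OF assms(2,3)]
  proof (rule arg_cong2[where f = "(+)"], rule sum.cong, goal_cases)
    case (2 l)
    have "pochhammer a l * pochhammer b 1 / pochhammer (a + b) (l + 1)
        + pochhammer a 1 * pochhammer b l / pochhammer (a + b) (1 + l)
        = (a * pochhammer b l + b * pochhammer a l) / pochhammer (a + b) (l + 1)"
      by (simp add: add_divide_distrib mult.commute)
    then show ?case
      by (simp only: of_real_add[symmetric]) (simp add: mult_ac)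
  next
    case 3
    have "pochhammer (a + b) (1 + 1) = (a + b + 1) * (a + b)"
      by (simp add: pochhammer_rec')
    then show ?case by (simp add: mult_ac)
  qed simp
  ultimately show ?thesis by simp
qed

end
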